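(* Let $p,q\ge 1$ be integers. (1) $\mathrm{Aut}(D_{p,q})$ acts transitively on $D_{p,q}$ and also on $\partial D_{p,q}$. (2) Let $[v_1],[v_2],[w_1],[w_2]\in\partial D_{p,q}$, where $[v_1]\ne[v_2]$ and $[w_1]\neq[w_2]$. Then there exists $M\in\mathrm{Aut}(D_{p,q})$ such that $M([v_j])=[w_j]$ for $j=1,2$ if and only if there exists a non-zero $\alpha\in\mathbb C$ such that $v_1^HH_{p,q}v_2=\alpha\, w_1^HH_{p,q}w_2$.
   Context: $\cdot^H$ is the Hermitian (conjugate) transpose and $H_{p,q}=\begin{pmatrix}I_p&0\\0&-I_q\end{pmatrix}$. For a nonzero $u\in\mathbb C^{p+q}$ (column vector), $[u]\in\mathbb P^{p+q-1}$ is its projectivization. The generalized ball is $D_{p,q}=\{[z]\in\mathbb P^{p+q-1}: z^HH_{p,q}z>0\}=\{[z_1,\dots,z_{p+q}] : |z_1|^2+\dots+|z_p|^2>|z_{p+1}|^2+\dots+|z_{p+q}|^2\}$, with boundary $\partial D_{p,q}=\{[z]: z^HH_{p,q}z=0\}$. $\mathrm{Aut}(D_{p,q})$ is the group of biholomorphic automorphisms of $D_{p,q}$. It is known that every automorphism of $D_{p,q}$ is the restriction of a projective linear map $[z]\mapsto[Az]$ with $A\in U(p,q)=\{A\in GL(p+q,\mathbb C):A^HH_{p,q}A=H_{p,q}\}$, so that $\mathrm{Aut}(D_{p,q})\cong PU(p,q)$; the action of $\mathrm{Aut}(D_{p,q})$ on $\partial D_{p,q}$ is given by these projective linear maps. 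*)

theory Defs
  imports "HOL-Analysis.Analysis"
begin

text \<open>
  Vectors of length p + q are indexed by the sum type 'p + 'q of two arbitrary finite (hence
  nonempty) types, so that p = CARD('p) and q = CARD('q) range over all integers at least 1.
\<close>

definition Hpq :: "complex ^ ('p::finite + 'q::finite) ^ ('p + 'q)" where
  "Hpq = (\<chi> i j. if i = j then (case i of Inl _ \<Rightarrow> 1 | Inr _ \<Rightarrow> -1) else 0)"

definition hermitian_transpose :: "complex ^ 'n ^ 'm \<Rightarrow> complex ^ 'm ^ 'n" where
  "hermitian_transpose A = (\<chi> i j. cnj (A $ j $ i))"

text \<open>The scalar \<open>u\<^sup>H Hpq v\<close>.\<close>

definition hform :: "complex ^ ('p::finite + 'q::finite) \<Rightarrow> complex ^ ('p + 'q) \<Rightarrow> complex" where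
  "hform u v = (\<Sum>i\<in>UNIV. cnj (u $ i) * (Hpq *v v) $ i)"

definition Upq :: "(complex ^ ('p::finite + 'q::finite) ^ ('p + 'q)) set" where
  "Upq = {A. invertible A \<and> hermitian_transpose A ** Hpq ** A = Hpq}"

text \<open>
  A point of projective space is the class of its nonzero homogeneous coordinate vectors.
\<close>

type_synonym 'n projpt = "(complex ^ 'n) set"

definition proj_point :: "complex ^ 'n \<Rightarrow> 'n projpt" where
  "proj_point u = {c *s u | c. c \<noteq> 0}"

text \<open>
  Taking the image of a class under an invertible \<open>A\<close> gives \<open>[z] \<mapsto> [Az]\<close>.
\<close>

definition proj_map :: "complex ^ 'n ^ 'n \<Rightarrow> 'n projpt \<Rightarrow> 'n projpt" where
  "proj_map A x = (\<lambda>v. A *v v) ` x"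

text \<open>
  \<open>hform z z\<close> is always real, so the real part below discards nothing; it is positive exactly if
  the first p coordinates outweigh the last q ones, see \<open>gen_ball_alt\<close>.
\<close>

definition gen_ball :: "('p::finite + 'q::finite) projpt set" where
  "gen_ball = {proj_point z | z. z \<noteq> 0 \<and> Re (hform z z) > 0}"

definition gen_ball_boundary :: "('p::finite + 'q::finite) projpt set" where
  "gen_ball_boundary = {proj_point z | z. z \<noteq> 0 \<and> hform z z = 0}"

text \<open>
  Holomorphy of a vector-valued function of several complex variables on an open set: the
  Frechet derivative exists everywhere and is complex linear.
\<close>

definition holomorphic_vec_on ::
    "(complex ^ 'n::finite \<Rightarrow> complex ^ 'm::finite) \<Rightarrow> (complex ^ 'n) set \<Rightarrow> bool" where
  "holomorphic_vec_on f W \<longleftrightarrow>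
     (\<forall>w\<in>W. \<exists>f'. (f has_derivative f') (at w) \<and> (\<forall>c x. f' (c *s x) = c *s f' x))"

text \<open>
  A map defined on a set \<open>U\<close> of projective points (open, in all uses) is holomorphic if locally it
  is given in homogeneous coordinates by holomorphic functions without common zero.
\<close>

definition proj_holomorphic_on ::
    "('n::finite projpt \<Rightarrow> 'm::finite projpt) \<Rightarrow> 'n projpt set \<Rightarrow> bool" where
  "proj_holomorphic_on F U \<longleftrightarrow>
     (\<forall>z. z \<noteq> 0 \<and> proj_point z \<in> U \<longrightarrow>
        (\<exists>W f. open W \<and> z \<in> W \<and> (\<forall>w\<in>W. w \<noteq> 0 \<and> proj_point w \<in> U) \<and>
               holomorphic_vec_on f W \<and>
               (\<forall>w\<in>W. f w \<noteq> 0 \<and> F (proj_point w) = proj_point (f w))))"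

text \<open>
  Biholomorphic self-maps of the generalized ball. Extensionality fixes the irrelevant values
  outside the ball, so that distinct elements are distinct automorphisms.
\<close>

definition gen_ball_aut :: "(('p::finite + 'q::finite) projpt \<Rightarrow> ('p + 'q) projpt) set" where
  "gen_ball_aut = {M. M \<in> extensional gen_ball \<and> bij_betw M gen_ball gen_ball \<and>
                      proj_holomorphic_on M gen_ball \<and>
                      proj_holomorphic_on (inv_into gen_ball M) gen_ball}"

text \<open>
  The action of an automorphism \<open>M\<close> on boundary points, \<open>M(x) = y\<close>: it is the one of a projective
  linear map with matrix in \<open>Upq\<close> that restricts to \<open>M\<close> on the ball. By \<open>boundary_action_unique\<close>
  the point \<open>y\<close> does not depend on the choice of the matrix. The action is stated as a relation so
  that it does not presuppose the theorem that each automorphism comes from such a matrix.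
\<close>

definition boundary_action ::
    "(('p::finite + 'q::finite) projpt \<Rightarrow> ('p + 'q) projpt) \<Rightarrow> ('p + 'q) projpt \<Rightarrow> ('p + 'q) projpt \<Rightarrow> bool" where
  "boundary_action M x y \<longleftrightarrow>
     x \<in> gen_ball_boundary \<and>
     (\<exists>A\<in>Upq. (\<forall>z\<in>gen_ball. M z = proj_map A z) \<and> y = proj_map A x)"

lemma hform_expand:
  "hform u v = (\<Sum>i\<in>UNIV. cnj (u $ Inl i) * v $ Inl i) - (\<Sum>j\<in>UNIV. cnj (u $ Inr j) * v $ Inr j)"
proof -
  have H: "(Hpq *v v) $ i = (case i of Inl _ \<Rightarrow> v $ i | Inr _ \<Rightarrow> - (v $ i))" for i
    by (simp add: Hpq_def matrix_vector_mult_def if_distrib[where f="\<lambda>x. x * _"]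
        cong: if_cong split: sum.split)
  show ?thesis
    unfolding hform_def H UNIV_sum
    by (subst sum.union_disjoint) (auto simp: sum.reindex sum_negf)
qed

lemma hform_self:
  "hform z z = of_real ((\<Sum>i\<in>UNIV. (cmod (z $ Inl i))\<^sup>2) - (\<Sum>j\<in>UNIV. (cmod (z $ Inr j))\<^sup>2))"
proof -
  have "cnj c * c = of_real ((cmod c)\<^sup>2)" for c :: complex
    by (metis complex_norm_square mult.commute)
  then show ?thesis unfolding hform_expand by simp
qed

lemma gen_ball_alt:
  "(gen_ball :: ('p::finite + 'q::finite) projpt set) =
     {proj_point z | z. z \<noteq> 0 \<and> (\<Sum>i\<in>UNIV. (cmod (z $ Inl i))\<^sup>2) > (\<Sum>j\<in>UNIV. (cmod (z $ Inr j))\<^sup>2)}"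
  unfolding gen_ball_def hform_self by simp

lemma proj_map_point: "proj_map A (proj_point u) = proj_point (A *v u)"
  by (force simp: proj_map_def proj_point_def vector_scalar_commute)

lemma proj_point_eqD:
  assumes "proj_point u = proj_point v"
  shows "\<exists>c. c \<noteq> 0 \<and> u = c *s v"
proof -
  have "u \<in> proj_point u" unfolding proj_point_def by (rule CollectI, rule exI[of _ 1]) simp
  then show ?thesis using assms unfolding proj_point_def by auto
qed

lemma proj_point_scale: "c \<noteq> 0 \<Longrightarrow> proj_point (c *s u) = proj_point u"
  unfolding proj_point_def
  apply safe
  subgoal for _ d by (rule exI[of _ "d * c"]) simp
  subgoal for _ d by (rule exI[of _ "d / c"]) simp
  done

lemma boundary_action_unique:
  fixes M :: "('p::finite + 'q::finite) projpt \<Rightarrow> ('p + 'q) projpt"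
  assumes "boundary_action M x y" "boundary_action M x y'"
  shows "y = y'"
proof -
  obtain A B v where A: "A \<in> Upq" "\<And>z. z \<in> gen_ball \<Longrightarrow> M z = proj_map A z" "y = proj_map A x"
    and B: "B \<in> Upq" "\<And>z. z \<in> gen_ball \<Longrightarrow> M z = proj_map B z" "y' = proj_map B x"
    and v: "x = proj_point v" "v \<noteq> 0" "hform v v = 0"
    using assms unfolding boundary_action_def gen_ball_boundary_def by blast
  have ev: "\<exists>c. c \<noteq> 0 \<and> A *v z = c *s (B *v z)" if "Re (hform z z) > 0" for z
  proof -
    have "z \<noteq> 0" using that by (auto simp: hform_self)
    then have "proj_point z \<in> gen_ball" using that unfolding gen_ball_def by blast
    then show ?thesis using A(2) B(2) by (metis proj_map_point proj_point_eqD)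
  qed
  define e :: "complex ^ ('p + 'q)" where "e = axis (Inl undefined) 1"
  have e: "Re (hform e e) > 0"
    unfolding hform_self e_def by (simp add: axis_def if_distrib[where f=cmod] if_distrib[where f="\<lambda>x. x\<^sup>2"] cong: if_cong)
  have "continuous_on UNIV (\<lambda>t::real. Re (hform (e + of_real t *s v) (e + of_real t *s v)))"
    unfolding hform_self by simp (intro continuous_intros)
  then have cont: "isCont (\<lambda>t::real. Re (hform (e + of_real t *s v) (e + of_real t *s v))) 0"
    by (simp add: continuous_on_eq_continuous_at)
  then have "\<forall>\<^sub>F t in at 0. Re (hform (e + of_real t *s v) (e + of_real t *s v)) > 0"
    using e by (auto simp: isCont_def intro: order_tendstoD(1))
  then obtain d where d: "d > 0" "\<And>t. t \<noteq> 0 \<Longrightarrow> \<bar>t\<bar> < d \<Longrightarrow> Re (hform (e + of_real t *s v) (e + of_real t *s v)) > 0"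
    unfolding eventually_at by (auto simp: dist_norm)
  define t where "t = d / 3"
  have t: "t > 0" "Re (hform (e + of_real t *s v) (e + of_real t *s v)) > 0"
    "Re (hform (e + of_real (2*t) *s v) (e + of_real (2*t) *s v)) > 0"
    using d(1) d(2)[of t] d(2)[of "2 * t"] by (simp_all add: t_def)
  obtain c where c: "c \<noteq> 0" "A *v e = c *s (B *v e)" using ev[OF e] by blast
  obtain c1 where c1: "A *v (e + of_real t *s v) = c1 *s (B *v (e + of_real t *s v))" using ev[OF t(2)] by blast
  obtain c2 where c2: "A *v (e + of_real (2*t) *s v) = c2 *s (B *v (e + of_real (2*t) *s v))" using ev[OF t(3)] by blast
  have e1: "of_real t *s (A *v v) = (c1 - c) *s (B *v e) + (of_real t * c1) *s (B *v v)"
    using c1 c(2) by (simp add: matrix_vector_right_distrib vector_scalar_commute[symmetric] vec_eq_iff algebra_simps)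
  have e2: "of_real (2*t) *s (A *v v) = (c2 - c) *s (B *v e) + (of_real (2*t) * c2) *s (B *v v)"
    using c2 c(2) by (simp add: matrix_vector_right_distrib vector_scalar_commute[symmetric] vec_eq_iff algebra_simps)
  have "(2 * (c1 - c) - (c2 - c)) *s (B *v e) + (of_real (2*t) * (c1 - c2)) *s (B *v v) = 
     2 *s (of_real t *s (A *v v)) - of_real (2*t) *s (A *v v)"
    unfolding e1 e2 by (simp add: vec_eq_iff algebra_simps)
  also have "\<dots> = 0" by (simp add: vec_eq_iff)
  finally have "B *v ((2 * (c1 - c) - (c2 - c)) *s e + (of_real (2*t) * (c1 - c2)) *s v) = 0"
    by (simp only: matrix_vector_right_distrib vector_scalar_commute)
  moreover obtain B' where "B' ** B = mat 1" using B(1) by (auto simp: Upq_def invertible_def)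
  then have "u = 0" if "B *v u = 0" for u
    using that by (metis matrix_vector_mul_assoc matrix_vector_mul_lid matrix_vector_mult_0_right)
  ultimately have z: "(2 * (c1 - c) - (c2 - c)) *s e + (of_real (2*t) * (c1 - c2)) *s v = 0"
    by blast
  have v0: "v \<noteq> k *s e" for k
  proof
    assume "v = k *s e"
    then have "hform v v = of_real ((cmod k)\<^sup>2) * hform e e"
      by (simp add: hform_self norm_mult power_mult_distrib sum_distrib_left algebra_simps)
    then have "k = 0" using v(3) e by auto
    then show False using v(2) \<open>v = k *s e\<close> by simp
  qed
  have eq: "c1 = c2"
  proof (rule ccontr)
    assume "c1 \<noteq> c2"
    define s where "s = of_real (2*t) * (c1 - c2)"
    have "s \<noteq> 0" using \<open>c1 \<noteq> c2\<close> t(1) by (simp add: s_def)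
    define k where "k = 2 * (c1 - c) - (c2 - c)"
    have k: "k * e $ i + s * v $ i = 0" for i
      using arg_cong[OF z, of "\<lambda>x. x $ i"] unfolding s_def[symmetric] k_def[symmetric] by simp
    have "v $ i = (- k / s) * e $ i" for i
    proof -
      have "s * v $ i = - (k * e $ i)" using k[of i] by (simp add: add_eq_0_iff)
      then have "s * v $ i / s = - (k * e $ i) / s" by simp
      then show ?thesis using \<open>s \<noteq> 0\<close> by simp
    qed
    then have "v = (- k / s) *s e" by (simp add: vec_eq_iff)
    then show False using v0 by blast
  qed
  have "e \<noteq> 0" using e by (auto simp: hform_self)
  with z eq have "c1 = c" by (simp add: algebra_simps vector_mul_eq_0)
  with e1 have "of_real t *s (A *v v) = of_real t *s (c *s (B *v v))"
    by (simp add: vec_eq_iff)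
  then have "A *v v = c *s (B *v v)" using t(1) by (simp add: vec_eq_iff)
  then show ?thesis using A(3) B(3) v(1) c(1) by (simp add: proj_map_point proj_point_scale)
qed

end

theory Submission
  imports Defs
begin

text \<open>
  If \<open>h(x,x) = h(y,y) \<noteq> h(y,x)\<close> and \<open>u = x - y\<close>, the quasi-reflection
  \<open>z \<mapsto> z - (h(u,z) / h(u,x)) u\<close> is an isometry of \<open>h\<close> that sends \<open>x\<close> to \<open>y\<close> and fixes every
  vector orthogonal to \<open>u\<close>. Vectors of positive norm can be scaled so that it applies. Two
  orthogonal isotropic vectors \<open>x\<close>, \<open>y\<close> are joined through a third isotropic vector \<open>z\<close> that is
  orthogonal to neither of them, and if moreover \<open>h(e,z) = h(e,x) = h(e,y)\<close>, then both
  quasi-reflections fix \<open>e\<close>. Moving first \<open>v\<^sub>1\<close> to \<open>w\<^sub>1\<close> and then \<open>v\<^sub>2\<close> to \<open>w\<^sub>2\<close> with \<open>w\<^sub>1\<close> fixed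
  gives the transitivity on pairs.
\<close>

section \<open>Sesquilinearity and nondegeneracy of the indefinite form\<close>

lemma hform_add_left: "hform (u + v) w = hform u w + hform v w"
  by (simp add: hform_def sum.distrib algebra_simps)

lemma hform_add_right: "hform u (v + w) = hform u v + hform u w"
  by (simp add: hform_expand sum.distrib algebra_simps)

lemma hform_scale_left: "hform (c *s u) w = cnj c * hform u w"
  by (simp add: hform_def sum_distrib_left algebra_simps)

lemma hform_scale_right: "hform u (c *s w) = c * hform u w"
  by (simp add: hform_expand sum_distrib_left algebra_simps)

lemma hform_diff_left: "hform (u - v) w = hform u w - hform v w"
  by (metis add_diff_cancel_right' diff_add_cancel hform_add_left)

lemma hform_diff_right: "hform u (v - w) = hform u v - hform u w"
  by (metis add_diff_cancel_right' diff_add_cancel hform_add_right)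

lemmas hform_linear = hform_add_left hform_add_right hform_scale_left hform_scale_right
  hform_diff_left hform_diff_right

lemma hform_zero_left [simp]: "hform 0 w = 0"
  by (simp add: hform_def)

lemma hform_cnj: "cnj (hform u v) = hform v u"
  by (simp add: hform_expand mult.commute)

lemma hform_eq_0_commute: "hform u v = 0 \<longleftrightarrow> hform v u = 0"
  by (metis hform_cnj complex_cnj_zero_iff)

lemma hform_self_Re: "hform z z = of_real (Re (hform z z))"
  by (simp add: hform_self)

lemma Hpq_nth: "(Hpq *v v) $ i = (case i of Inl _ \<Rightarrow> v $ i | Inr _ \<Rightarrow> - (v $ i))"
  by (simp add: Hpq_def matrix_vector_mult_def if_distrib[where f="\<lambda>x. x * _"]
      cong: if_cong split: sum.split)

lemma hform_Hpq_Hpq: "hform (Hpq *v u) (Hpq *v v) = hform u v"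
  by (simp add: hform_expand Hpq_nth)

lemma hform_Hpq_left: "hform (Hpq *v u) v = hform u (Hpq *v v)"
  by (simp add: hform_expand Hpq_nth sum_negf)

text \<open>As \<open>Hpq\<close> squares to the identity, \<open>hform (Hpq *v u) v\<close> is the
  standard Hermitian product of \<open>u\<close> and \<open>v\<close>, which is definite. It yields
  nondegeneracy of \<open>hform\<close> and expresses Euclidean orthogonality further below.\<close>

lemma hform_Hpq_self_eq_0: "hform (Hpq *v u) u = 0 \<longleftrightarrow> u = 0"
proof
  assume "hform (Hpq *v u) u = 0"
  moreover have "hform (Hpq *v u) u
      = of_real ((\<Sum>i\<in>UNIV. (cmod (u $ Inl i))\<^sup>2) + (\<Sum>j\<in>UNIV. (cmod (u $ Inr j))\<^sup>2))"
  proof -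
    have "cnj c * c = of_real ((cmod c)\<^sup>2)" for c :: complex
      by (metis complex_norm_square mult.commute)
    then show ?thesis by (simp add: hform_expand Hpq_nth sum_negf)
  qed
  ultimately have "(\<Sum>i\<in>UNIV. (cmod (u $ Inl i))\<^sup>2) + (\<Sum>j\<in>UNIV. (cmod (u $ Inr j))\<^sup>2) = 0"
    by (metis of_real_eq_0_iff)
  then have "(\<Sum>i\<in>UNIV. (cmod (u $ Inl i))\<^sup>2) = 0" "(\<Sum>j\<in>UNIV. (cmod (u $ Inr j))\<^sup>2) = 0"
    by (simp_all add: add_nonneg_eq_0_iff sum_nonneg)
  then have "u $ Inl i = 0" "u $ Inr j = 0" for i j
    by (simp_all add: sum_nonneg_eq_0_iff)
  then have "u $ k = 0" for k by (cases k) auto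
  then show "u = 0" by (simp add: vec_eq_iff)
qed (simp add: hform_def)

lemma hform_nondegenerate: "(\<And>v. hform u v = 0) \<Longrightarrow> u = 0"
  using hform_Hpq_self_eq_0 hform_Hpq_left by metis

section \<open>The unitary group as the isometry group of the form\<close>

lemma hform_matrix:
  "hform (A *v x) (A *v y)
     = (\<Sum>i\<in>UNIV. cnj (x $ i) * ((hermitian_transpose A ** Hpq ** A) *v y) $ i)"
proof -
  define w where "w = Hpq *v (A *v y)"
  have "hform (A *v x) (A *v y) = (\<Sum>i\<in>UNIV. \<Sum>j\<in>UNIV. cnj (A $ i $ j) * cnj (x $ j) * w $ i)"
    unfolding hform_def w_def[symmetric]
    by (simp add: matrix_vector_mult_def sum_distrib_right)
  also have "\<dots> = (\<Sum>j\<in>UNIV. \<Sum>i\<in>UNIV. cnj (A $ i $ j) * cnj (x $ j) * w $ i)"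
    by (rule sum.swap)
  also have "\<dots> = (\<Sum>j\<in>UNIV. cnj (x $ j) * (hermitian_transpose A *v w) $ j)"
    by (simp add: matrix_vector_mult_def hermitian_transpose_def sum_distrib_left ac_simps)
  finally show ?thesis
    by (simp add: w_def matrix_vector_mul_assoc matrix_mul_assoc)
qed

lemma Upq_hform: "A \<in> Upq \<Longrightarrow> hform (A *v x) (A *v y) = hform x y"
  unfolding hform_matrix by (simp add: Upq_def hform_def)

text \<open>Nondegeneracy makes an isometry injective, hence invertible. Evaluating the preserved
  form on pairs of basis vectors recovers the matrix equation entry by entry.\<close>

lemma Upq_I:
  fixes A :: "complex ^ ('p::finite + 'q::finite) ^ ('p + 'q)"
  assumes "\<And>x y. hform (A *v x) (A *v y) = hform x y"
  shows "A \<in> Upq"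
proof -
  have "x = 0" if "A *v x = 0" for x
  proof (rule hform_nondegenerate)
    show "hform x v = 0" for v using assms[of x v] that by simp
  qed
  then have "invertible A"
    by (simp add: invertible_left_inverse matrix_left_invertible_ker)
  moreover have "hermitian_transpose A ** Hpq ** A = Hpq" (is "?B = Hpq")
  proof -
    have cnj_axis: "cnj ((axis i 1 :: complex ^ ('p + 'q)) $ k) = (if k = i then 1 else 0)" for i k
      by (simp add: axis_def)
    have "(?B *v axis j 1) $ i = (Hpq *v axis j 1) $ i" for i j
      using assms[of "axis i 1" "axis j 1"] unfolding hform_matrix
      by (simp add: hform_def cnj_axis if_distrib[where f="\<lambda>x. x * _"] cong: if_cong)
    moreover have "(M *v axis j 1) $ i = M $ i $ j" for M :: "complex ^ ('p + 'q) ^ ('p + 'q)" and i j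
      by (simp add: matrix_vector_mult_def axis_def if_distrib cong: if_cong)
    ultimately show ?thesis
      by (simp add: vec_eq_iff)
  qed
  ultimately show ?thesis by (simp add: Upq_def)
qed

lemma Upq_mult:
  assumes "A \<in> Upq" "B \<in> Upq"
  shows "A ** B \<in> Upq"
  by (rule Upq_I) (simp add: matrix_vector_mul_assoc[symmetric] Upq_hform assms)

lemma Upq_inverse:
  assumes "A \<in> Upq"
  obtains B where "B \<in> Upq" "\<And>v. A *v (B *v v) = v" "\<And>v. B *v (A *v v) = v"
proof -
  obtain B where B: "A ** B = mat 1" "B ** A = mat 1"
    using assms by (auto simp: Upq_def invertible_def)
  then have *: "A *v (B *v v) = v" "B *v (A *v v) = v" for v
    by (simp_all add: matrix_vector_mul_assoc)
  have "B \<in> Upq"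
    by (rule Upq_I) (metis Upq_hform[OF assms] *(1))
  with * show ?thesis by (rule that[rotated])
qed

section \<open>Isometries moving isotropic vectors\<close>

lemma quasi_reflection:
  fixes x y :: "complex ^ ('p::finite + 'q::finite)"
  assumes eq: "hform x x = hform y y" and ne: "hform y x \<noteq> hform x x"
  obtains A where "A \<in> Upq" "A *v x = y" "\<And>e. hform e x = hform e y \<Longrightarrow> A *v e = e"
proof -
  define u where "u = x - y"
  define c where "c = hform u x"
  define R where "R = (\<lambda>z. z - (hform u z / c) *s u)"
  have c0: "c \<noteq> 0" using ne by (simp add: c_def u_def hform_linear)
  \<comment> \<open>Both sides are \<open>2 h(x,x) - h(x,y) - h(y,x)\<close>, with \<open>h\<close>
    for \<open>hform\<close>. This identity cancels the correction term when
    \<open>hform (R z) (R w)\<close> is expanded.\<close>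
  have cc: "c + cnj c = hform u u"
    by (simp add: c_def u_def hform_linear hform_cnj eq)
  have "Vector_Spaces.linear (*s) (*s) R"
    unfolding Vector_Spaces.linear_def module_hom_def module_hom_axioms_def
    by (auto simp: vec.vector_space_axioms vec.module_axioms R_def hform_linear vec_eq_iff
        algebra_simps add_divide_distrib)
  then have AR: "matrix R *v z = R z" for z by (rule matrix_works)
  show thesis
  proof
    show "matrix R \<in> Upq"
    proof (rule Upq_I)
      fix z w
      have "hform (R z) (R w) = hform z w + cnj (hform u z) * hform u w *
              (hform u u - c - cnj c) / (c * cnj c)"
        using c0 by (simp add: R_def hform_linear hform_cnj field_simps)
      also have "hform u u - c - cnj c = 0" using cc by (simp add: algebra_simps)
      finally show "hform (matrix R *v z) (matrix R *v w) = hform z w" by (simp add: AR)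
    qed
    show "matrix R *v x = y"
    proof -
      have "R x = x - u" using c0 by (simp add: R_def c_def[symmetric])
      then show ?thesis by (simp add: AR u_def)
    qed
    show "matrix R *v e = e" if "hform e x = hform e y" for e
    proof -
      have "hform e u = 0"
        using that by (simp add: u_def hform_linear)
      then have "hform u e = 0"
        using hform_eq_0_commute by blast
      then have "R e = e" by (simp add: R_def)
      then show ?thesis by (simp add: AR)
    qed
  qed
qed

text \<open>\<open>Hpq *v v\<close> is isotropic because \<open>Hpq\<close> is an isometry, and it
  pairs with \<open>v\<close> to the squared Euclidean norm of \<open>v\<close>. It serves as
  \<open>z\<close> unless \<open>v\<close> and \<open>w\<close> are Euclidean orthogonal; then its
  sum with \<open>Hpq *v w\<close> does, which is isotropic because \<open>hform v w = 0\<close>.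
  Either way \<open>z\<close> lies in the span of \<open>Hpq *v v\<close> and
  \<open>Hpq *v w\<close>, whence the last conclusion.\<close>

lemma isotropic_connect:
  assumes "v \<noteq> 0" "w \<noteq> 0" "hform v v = 0" "hform w w = 0" "hform v w = 0"
  obtains z where "hform z z = 0" "hform z v \<noteq> 0" "hform z w \<noteq> 0"
    "\<And>e. hform (Hpq *v v) e = 0 \<Longrightarrow> hform (Hpq *v w) e = 0 \<Longrightarrow> hform z e = 0"
proof (cases "hform (Hpq *v v) w = 0")
  case False
  show ?thesis
    using False assms by (intro that[of "Hpq *v v"]) (simp_all add: hform_Hpq_Hpq hform_Hpq_self_eq_0)
next
  case True
  then have "hform (Hpq *v w) v = 0"
    by (metis hform_eq_0_commute hform_Hpq_left)
  moreover have "hform w v = 0" using assms hform_eq_0_commute by blast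
  ultimately show ?thesis
    using True assms
    by (intro that[of "Hpq *v v + Hpq *v w"])
      (simp_all add: hform_linear hform_Hpq_Hpq hform_Hpq_self_eq_0)
qed

lemma isotropic_move_via:
  assumes "hform x x = 0" "hform y y = 0" "hform z z = 0"
    and "hform z x \<noteq> 0" "hform z y \<noteq> 0"
    and "hform e x = hform e z" "hform e z = hform e y"
  obtains A where "A \<in> Upq" "A *v x = y" "A *v e = e"
proof -
  obtain A where A: "A \<in> Upq" "A *v x = z" "A *v e = e"
    using quasi_reflection[of x z] assms by metis
  have "hform y z \<noteq> 0" using assms(5) hform_eq_0_commute by blast
  then obtain B where B: "B \<in> Upq" "B *v z = y" "B *v e = e"
    using quasi_reflection[of z y] assms by metis
  show thesis
    by (rule that[of "B ** A"]) (simp_all add: A B Upq_mult matrix_vector_mul_assoc[symmetric])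
qed

lemma isotropic_move:
  assumes "x \<noteq> 0" "y \<noteq> 0" "hform x x = 0" "hform y y = 0"
  obtains A where "A \<in> Upq" "A *v x = y"
proof (cases "hform x y = 0")
  case False
  then have "hform y x \<noteq> 0" using hform_eq_0_commute by blast
  then show ?thesis using quasi_reflection[of x y] assms that by metis
next
  case True
  then obtain z where "hform z z = 0" "hform z x \<noteq> 0" "hform z y \<noteq> 0"
    using isotropic_connect[of x y] assms by metis
  \<comment> \<open>With 0 as the vector to be kept fixed, the conditions on it hold
    trivially.\<close>
  then show ?thesis
    using isotropic_move_via[of x y z 0] assms that by auto
qed

text \<open>This moves the second vector of a pair while the first stays in place. A single
  quasi-reflection suffices unless \<open>x\<close> and \<open>y\<close> are orthogonal. Otherwise
  the intermediate vector is built from \<open>x\<close> and \<open>e\<close> if these are not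
  orthogonal, and from Euclidean projections along \<open>e\<close> if they are; independence from
  \<open>e\<close> keeps those projections nonzero.\<close>

lemma isotropic_move_fixing:
  fixes e x y :: "complex ^ ('p::finite + 'q::finite)"
  assumes iso: "hform e e = 0" "hform x x = 0" "hform y y = 0" and "e \<noteq> 0"
    and indep: "\<And>k. x \<noteq> k *s e" "\<And>k. y \<noteq> k *s e"
    and eq: "hform e x = hform e y"
  obtains A where "A \<in> Upq" "A *v e = e" "A *v x = y"
proof -
  consider "hform x y \<noteq> 0" | "hform x y = 0" "hform e x \<noteq> 0" | "hform x y = 0" "hform e x = 0"
    by blast
  then show thesis
  proof cases
    case 1
    then have "hform y x \<noteq> 0" using hform_eq_0_commute by blast
    then show ?thesis using quasi_reflection[of x y] iso eq that by metis
  next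
    case 2
    define c where "c = hform e x"
    \<comment> \<open>The factor \<open>\<i> * c\<close> makes the cross term
      \<open>hform x ((\<i> * c) *s e)\<close> purely imaginary, so it cancels against its conjugate
      and \<open>z\<close> stays isotropic.\<close>
    define z where "z = x + (\<i> * c) *s e"
    have c: "hform e y = c" "hform x e = cnj c" "hform e x = c"
      unfolding c_def hform_cnj by (simp_all add: eq)
    have "hform z z = 0" "hform z x = - \<i> * cnj c * c" "hform z y = - \<i> * cnj c * c"
      "hform e z = c"
      using 2 by (simp_all add: z_def hform_linear iso c)
    then show ?thesis
      using isotropic_move_via[of x y z e] iso c 2(2) that by auto
  next
    case 3
    define f where "f = hform (Hpq *v e)"
    have fe: "f e \<noteq> 0" using \<open>e \<noteq> 0\<close> by (simp add: f_def hform_Hpq_self_eq_0)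
    \<comment> \<open>Euclidean projections to the orthogonal complement of \<open>e\<close>\<close>
    define v where "v = x - (f x / f e) *s e"
    define w where "w = y - (f y / f e) *s e"
    have ex: "hform e y = 0" "hform e x = 0" "hform y e = 0" "hform x e = 0"
      using 3 eq hform_eq_0_commute by metis+
    have nz: "v \<noteq> 0" "w \<noteq> 0" using indep by (simp_all add: v_def w_def)
    \<comment> \<open>Since \<open>e\<close> is isotropic and orthogonal to \<open>x\<close> and
      \<open>y\<close>, subtracting multiples of \<open>e\<close> leaves these form values
      unchanged.\<close>
    have "hform v v = 0" "hform w w = 0" "hform v w = 0"
      by (simp_all add: v_def w_def hform_linear ex iso 3)
    then obtain z where z: "hform z z = 0" "hform z v \<noteq> 0" "hform z w \<noteq> 0"
      "\<And>e. hform (Hpq *v v) e = 0 \<Longrightarrow> hform (Hpq *v w) e = 0 \<Longrightarrow> hform z e = 0"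
      using isotropic_connect[OF nz] by metis
    \<comment> \<open>So \<open>e\<close> is Euclidean orthogonal to \<open>v\<close> and
      \<open>w\<close>, and the last property of \<open>z\<close> gives
      \<open>hform z e = 0\<close>. Adding back multiples of \<open>e\<close> then does not alter
      the values of \<open>hform z\<close> on \<open>v\<close> and \<open>w\<close>.\<close>
    have "f v = 0" "f w = 0"
      using fe by (simp_all add: v_def w_def f_def hform_linear)
    then have ze: "hform z e = 0"
      using z(4) by (metis f_def hform_Hpq_left hform_eq_0_commute)
    then have "hform z x \<noteq> 0" "hform z y \<noteq> 0"
      using z(2,3) by (simp_all add: v_def w_def hform_linear)
    moreover have "hform e z = 0" using ze hform_eq_0_commute by blast
    ultimately show ?thesis
      using isotropic_move_via[of x y z e] iso z(1) ex that by metis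
  qed
qed

lemma isotropic_pair_move:
  fixes v1 v2 w1 w2 :: "complex ^ ('p::finite + 'q::finite)"
  assumes iso: "hform v1 v1 = 0" "hform v2 v2 = 0" "hform w1 w1 = 0" "hform w2 w2 = 0"
    and nz: "v1 \<noteq> 0" "w1 \<noteq> 0"
    and indep: "\<And>k. v2 \<noteq> k *s v1" "\<And>k. w2 \<noteq> k *s w1"
    and eq: "hform v1 v2 = hform w1 w2"
  obtains A where "A \<in> Upq" "A *v v1 = w1" "A *v v2 = w2"
proof -
  obtain A where A: "A \<in> Upq" "A *v v1 = w1"
    using isotropic_move[of v1 w1] iso nz by metis
  obtain A' where A': "\<And>v. A' *v (A *v v) = v" using Upq_inverse[OF A(1)] by metis
  \<comment> \<open>If equality held, applying \<open>A'\<close> would give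
    \<open>v2 = k *s v1\<close>.\<close>
  have "A *v v2 \<noteq> k *s w1" for k
    using A(2) A' indep(1) by (metis vector_scalar_commute)
  moreover have "hform w1 (A *v v2) = hform w1 w2"
    using Upq_hform[OF A(1), of v1 v2] A(2) eq by simp
  moreover have "hform (A *v v2) (A *v v2) = 0" using Upq_hform[OF A(1)] iso by simp
  ultimately obtain B where "B \<in> Upq" "B *v w1 = w1" "B *v (A *v v2) = w2"
    using isotropic_move_fixing[of w1 "A *v v2" w2] iso nz indep by metis
  with A show thesis
    by (intro that[of "B ** A"]) (simp_all add: Upq_mult matrix_vector_mul_assoc[symmetric])
qed

section \<open>Points of the ball and its boundary, and automorphisms given by matrices\<close>

lemma proj_point_in_gen_ball: "proj_point z \<in> gen_ball \<longleftrightarrow> Re (hform z z) > 0"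
proof
  assume "proj_point z \<in> gen_ball"
  then obtain w where w: "proj_point z = proj_point w" "Re (hform w w) > 0"
    unfolding gen_ball_def by blast
  then obtain c where c: "c \<noteq> 0" "z = c *s w" using proj_point_eqD by blast
  \<comment> \<open>Rescaling a representative multiplies the form by a positive real, so its sign
    depends only on the class.\<close>
  have "hform z z = of_real ((cmod c)\<^sup>2) * hform w w"
    by (simp only: c(2) hform_scale_left hform_scale_right complex_norm_square mult.assoc)
  then have "Re (hform z z) = (cmod c)\<^sup>2 * Re (hform w w)"
    by simp
  then show "Re (hform z z) > 0" using w(2) c(1) by simp
next
  assume "Re (hform z z) > 0"
  moreover from this have "z \<noteq> 0" by auto
  ultimately show "proj_point z \<in> gen_ball"
    unfolding gen_ball_def by blast
qed

text \<open>The zero vector must be excluded: \<open>hform 0 0 = 0\<close>, but its class is not a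
  projective point.\<close>

lemma proj_point_in_gen_ball_boundary:
  assumes "z \<noteq> 0"
  shows "proj_point z \<in> gen_ball_boundary \<longleftrightarrow> hform z z = 0"
proof
  assume "proj_point z \<in> gen_ball_boundary"
  then obtain w where w: "proj_point z = proj_point w" "hform w w = 0"
    unfolding gen_ball_boundary_def by blast
  then obtain c where "z = c *s w" using proj_point_eqD by blast
  then show "hform z z = 0" using w(2) by (simp add: hform_linear)
next
  assume "hform z z = 0"
  then show "proj_point z \<in> gen_ball_boundary"
    unfolding gen_ball_boundary_def using assms by blast
qed

lemma gen_ball_cases:
  assumes "x \<in> gen_ball"
  obtains z where "x = proj_point z" "Re (hform z z) > 0"
  using assms unfolding gen_ball_def by blast

text \<open>The linear map is its own holomorphic lift on the whole open cone over the ball, without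
  zeros by injectivity. Only agreement of \<open>F\<close> with \<open>proj_map A\<close> on the
  ball is asked, so that the result covers both a restricted map and an
  \<open>inv_into\<close>.\<close>

lemma proj_map_holomorphic:
  fixes A :: "complex ^ ('p::finite + 'q::finite) ^ ('p + 'q)"
  assumes "A \<in> Upq" and F: "\<And>z. z \<in> gen_ball \<Longrightarrow> F z = proj_map A z"
  shows "proj_holomorphic_on F gen_ball"
  unfolding proj_holomorphic_on_def
proof (intro allI impI)
  obtain B where B: "\<And>v. B *v (A *v v) = v" using Upq_inverse[OF assms(1)] by metis
  fix z :: "complex ^ ('p + 'q)"
  assume z: "z \<noteq> 0 \<and> proj_point z \<in> gen_ball"
  define W where "W = {w :: complex ^ ('p + 'q). Re (hform w w) > 0}"
  have "open W"
    unfolding W_def hform_self by simp (intro open_Collect_less continuous_intros)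
  moreover have "z \<in> W" using z by (simp add: W_def proj_point_in_gen_ball)
  moreover have W: "w \<noteq> 0 \<and> proj_point w \<in> gen_ball" if "w \<in> W" for w
    using that by (auto simp: W_def proj_point_in_gen_ball)
  moreover have "holomorphic_vec_on ((*v) A) W"
    unfolding holomorphic_vec_on_def
  proof (intro ballI exI conjI allI)
    show "((*v) A has_derivative (*v) A) (at w)" for w
      by (intro linear_imp_has_derivative linearI)
        (simp add: matrix_vector_right_distrib,
          simp add: vec_eq_iff matrix_vector_mult_def scaleR_sum_right)
  qed (simp add: vector_scalar_commute)
  moreover have "A *v w \<noteq> 0 \<and> F (proj_point w) = proj_point (A *v w)" if "w \<in> W" for w
    using W[OF that] B[of w] by (auto simp: F proj_map_point)
  ultimately show "\<exists>W f. open W \<and> z \<in> W \<and> (\<forall>w\<in>W. w \<noteq> 0 \<and> proj_point w \<in> gen_ball) \<and>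
      holomorphic_vec_on f W \<and> (\<forall>w\<in>W. f w \<noteq> 0 \<and> F (proj_point w) = proj_point (f w))"
    by (intro exI[of _ W] exI[of _ "(*v) A"]) simp
qed

text \<open>Isometries preserve the sign of the form, so \<open>A\<close> and its inverse
  \<open>B\<close> both map the ball into itself. On the ball the inverse function is the map of
  \<open>B\<close>, hence holomorphic for the same reason.\<close>

lemma Upq_gen_ball_aut:
  fixes A :: "complex ^ ('p::finite + 'q::finite) ^ ('p + 'q)"
  assumes "A \<in> Upq"
  shows "restrict (proj_map A) gen_ball \<in> gen_ball_aut" (is "?M \<in> _")
proof -
  obtain B where B: "B \<in> Upq" "\<And>v. A *v (B *v v) = v" "\<And>v. B *v (A *v v) = v"
    using Upq_inverse[OF assms] by blast
  have maps: "proj_map C x \<in> gen_ball" if "C \<in> Upq" "x \<in> gen_ball"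
    for C and x :: "('p + 'q) projpt"
    using that(2) by (auto elim!: gen_ball_cases simp: proj_map_point proj_point_in_gen_ball Upq_hform that(1))
  have inv: "proj_map A (proj_map B x) = x" "proj_map B (proj_map A x) = x" for x
    by (simp_all add: proj_map_def image_image B)
  have bij: "bij_betw ?M gen_ball gen_ball"
    by (rule bij_betw_byWitness[of _ "proj_map B"]) (auto simp: inv maps assms B(1))
  have "inv_into gen_ball ?M y = proj_map B y" if "y \<in> gen_ball" for y
    using that by (intro inv_into_f_eq bij_betw_imp_inj_on[OF bij]) (auto simp: inv maps B(1))
  then have "proj_holomorphic_on (inv_into gen_ball ?M) gen_ball"
    by (rule proj_map_holomorphic[OF B(1)])
  moreover have "proj_holomorphic_on ?M gen_ball"
    by (rule proj_map_holomorphic[OF assms]) simp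
  ultimately show ?thesis using bij by (simp add: gen_ball_aut_def)
qed

lemma Upq_boundary_action:
  assumes "A \<in> Upq" "proj_point v \<in> gen_ball_boundary" "A *v v = w"
  shows "boundary_action (restrict (proj_map A) gen_ball) (proj_point v) (proj_point w)"
  unfolding boundary_action_def using assms by (auto simp: proj_map_point intro!: bexI[of _ A])

section \<open>Transitivity on points and on pairs of boundary points\<close>

lemma gen_ball_transitive:
  fixes x y :: "('p::finite + 'q::finite) projpt"
  assumes "x \<in> gen_ball" "y \<in> gen_ball"
  shows "\<exists>M\<in>gen_ball_aut. M x = y"
proof -
  obtain u where u: "x = proj_point u" "Re (hform u u) > 0" using assms(1) by (rule gen_ball_cases)
  obtain v where v: "y = proj_point v" "Re (hform v v) > 0" using assms(2) by (rule gen_ball_cases)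
  define a where "a = Re (hform u u)"
  define b where "b = Re (hform v v)"
  have ab: "a > 0" "b > 0" "hform u u = of_real a" "hform v v = of_real b"
    using u v by (auto simp: a_def b_def hform_self_Re[symmetric])
  \<comment> \<open>This scaling gives \<open>v\<close> the same norm as \<open>u\<close>.\<close>
  define r where "r = sqrt (a / b)"
  have r: "r > 0" "r * r * b = a" using ab by (simp_all add: r_def)
  have norm: "hform (of_real s *s v) (of_real s *s v) = of_real (s * s * b)" for s
    by (simp add: hform_scale_left hform_scale_right ab)
  \<comment> \<open>The quasi-reflection is undefined if
    \<open>hform (c *s v) u = hform u u\<close>. If this happens for \<open>c = r\<close>, then
    \<open>c = - r\<close> gives \<open>- hform u u\<close> instead, which differs because
    \<open>hform u u\<close> is positive.\<close>
  have "\<exists>c. c \<noteq> 0 \<and> hform (c *s v) (c *s v) = hform u u \<and> hform (c *s v) u \<noteq> hform u u"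
  proof (cases "hform (of_real r *s v) u = hform u u")
    case False
    then show ?thesis
      using r norm[of r] ab(3) by (intro exI[of _ "of_real r"]) simp
  next
    case True
    then have "hform (of_real (- r) *s v) u \<noteq> hform u u"
      using ab unfolding hform_scale_left by simp
    moreover have "hform (of_real (- r) *s v) (of_real (- r) *s v) = hform u u"
      unfolding norm using r ab(3) by simp
    ultimately show ?thesis
      using r by (intro exI[of _ "of_real (- r)"]) auto
  qed
  then obtain c where c: "c \<noteq> 0" "hform (c *s v) (c *s v) = hform u u"
    "hform (c *s v) u \<noteq> hform u u" by blast
  then obtain A where A: "A \<in> Upq" "A *v u = c *s v"
    using quasi_reflection[of u "c *s v"] by metis
  have "restrict (proj_map A) gen_ball x = y"
    using assms(1) by (simp add: u(1) v(1) proj_map_point A(2) proj_point_scale c(1))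
  then show ?thesis using Upq_gen_ball_aut[OF A(1)] by blast
qed

lemma gen_ball_boundary_transitive:
  fixes x y :: "('p::finite + 'q::finite) projpt"
  assumes "x \<in> gen_ball_boundary" "y \<in> gen_ball_boundary"
  shows "\<exists>M\<in>gen_ball_aut. boundary_action M x y"
proof -
  obtain u v where "x = proj_point u" "u \<noteq> 0" "hform u u = 0"
    and "y = proj_point v" "v \<noteq> 0" "hform v v = 0"
    using assms unfolding gen_ball_boundary_def by blast
  moreover from this obtain A where "A \<in> Upq" "A *v u = v"
    using isotropic_move[of u v] by blast
  ultimately show ?thesis
    using Upq_gen_ball_aut[of A] Upq_boundary_action[of A u v] assms by blast
qed

text \<open>An isometry preserves \<open>hform v1 v2\<close>, while its images of the
  \<open>v\<close>'s are fixed only up to scalars by the projective points; this produces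
  \<open>\<alpha>\<close>. Conversely, \<open>\<alpha>\<close> is absorbed into the representative
  of the second target point, which reduces the claim to vectors with equal form values.\<close>

lemma gen_ball_boundary_pairs:
  fixes v1 v2 w1 w2 :: "complex ^ ('p::finite + 'q::finite)"
  assumes nz: "v1 \<noteq> 0" "v2 \<noteq> 0" "w1 \<noteq> 0" "w2 \<noteq> 0"
    and bd: "proj_point v1 \<in> gen_ball_boundary" "proj_point v2 \<in> gen_ball_boundary"
      "proj_point w1 \<in> gen_ball_boundary" "proj_point w2 \<in> gen_ball_boundary"
    and ne: "proj_point v1 \<noteq> proj_point v2" "proj_point w1 \<noteq> proj_point w2"
  shows "(\<exists>M\<in>gen_ball_aut. boundary_action M (proj_point v1) (proj_point w1) \<and>
                            boundary_action M (proj_point v2) (proj_point w2)) \<longleftrightarrow>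
         (\<exists>\<alpha>. \<alpha> \<noteq> 0 \<and> hform v1 v2 = \<alpha> * hform w1 w2)" (is "?L \<longleftrightarrow> ?R")
proof
  assume ?L
  then obtain M where M1: "boundary_action M (proj_point v1) (proj_point w1)"
    and M: "boundary_action M (proj_point v2) (proj_point w2)"
    by blast
  from M1 obtain A where A: "A \<in> Upq" "\<forall>z\<in>gen_ball. M z = proj_map A z"
    "proj_point w1 = proj_map A (proj_point v1)"
    unfolding boundary_action_def by blast
  \<comment> \<open>The two boundary actions may come with different matrices; uniqueness lets the
    one found for the first point serve for the second as well.\<close>
  have "boundary_action M (proj_point v2) (proj_map A (proj_point v2))"
    unfolding boundary_action_def using A(1,2) bd(2) by blast
  then have "proj_point w2 = proj_map A (proj_point v2)"
    by (rule boundary_action_unique[OF M])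
  then obtain c d where "c \<noteq> 0" "A *v v1 = c *s w1" "d \<noteq> 0" "A *v v2 = d *s w2"
    using A(3) proj_point_eqD unfolding proj_map_point by metis
  moreover from this have "hform v1 v2 = hform (c *s w1) (d *s w2)"
    using Upq_hform[OF A(1), of v1 v2] by simp
  then have "hform v1 v2 = (cnj c * d) * hform w1 w2"
    by (simp add: hform_linear)
  ultimately show ?R by (intro exI[of _ "cnj c * d"]) simp
next
  assume ?R
  then obtain \<alpha> where \<alpha>: "\<alpha> \<noteq> 0" "hform v1 v2 = \<alpha> * hform w1 w2" by blast
  have iso: "hform v1 v1 = 0" "hform v2 v2 = 0" "hform w1 w1 = 0" "hform w2 w2 = 0"
    using bd by (simp_all add: nz proj_point_in_gen_ball_boundary)
  \<comment> \<open>Distinct projective points thus have linearly independent representatives;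
    \<open>a \<noteq> 0\<close> rules out \<open>k = 0\<close>.\<close>
  have scale: "proj_point a = proj_point b" if "a = k *s b" "a \<noteq> 0" for k and a b :: "complex ^ ('p + 'q)"
    using that by (cases "k = 0") (simp_all add: proj_point_scale)
  have "v2 \<noteq> k *s v1" for k
    using scale[of v2 k v1] ne(1) nz(2) by auto
  moreover have "\<alpha> *s w2 \<noteq> k *s w1" for k
  proof
    assume "\<alpha> *s w2 = k *s w1"
    then have "proj_point (\<alpha> *s w2) = proj_point w1"
      by (rule scale) (simp add: vector_mul_eq_0 nz(4) \<alpha>(1))
    then show False using ne(2) \<alpha>(1) by (simp add: proj_point_scale)
  qed
  moreover have "hform (\<alpha> *s w2) (\<alpha> *s w2) = 0" "hform v1 v2 = hform w1 (\<alpha> *s w2)"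
    using iso \<alpha> by (simp_all add: hform_linear)
  ultimately obtain A where A: "A \<in> Upq" "A *v v1 = w1" "A *v v2 = \<alpha> *s w2"
    using isotropic_pair_move[OF iso(1,2,3) _ nz(1,3)] by blast
  have "boundary_action (restrict (proj_map A) gen_ball) (proj_point v1) (proj_point w1)"
    "boundary_action (restrict (proj_map A) gen_ball) (proj_point v2) (proj_point w2)"
    using Upq_boundary_action[OF A(1) bd(1) A(2)] Upq_boundary_action[OF A(1) bd(2) A(3)] \<alpha>(1)
    by (simp_all add: proj_point_scale)
  then show ?L using Upq_gen_ball_aut[OF A(1)] by blast
qed

theorem theorem3p4:
  shows
    "(\<forall>x\<in>(gen_ball :: ('p::finite + 'q::finite) projpt set). \<forall>y\<in>gen_ball.
        \<exists>M\<in>gen_ball_aut. M x = y) \<and>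
     (\<forall>x\<in>(gen_ball_boundary :: ('p + 'q) projpt set). \<forall>y\<in>gen_ball_boundary.
        \<exists>M\<in>gen_ball_aut. boundary_action M x y) \<and>
     (\<forall>v1 v2 w1 w2 :: complex ^ ('p + 'q).
        v1 \<noteq> 0 \<and> v2 \<noteq> 0 \<and> w1 \<noteq> 0 \<and> w2 \<noteq> 0 \<and>
        proj_point v1 \<in> gen_ball_boundary \<and> proj_point v2 \<in> gen_ball_boundary \<and>
        proj_point w1 \<in> gen_ball_boundary \<and> proj_point w2 \<in> gen_ball_boundary \<and>
        proj_point v1 \<noteq> proj_point v2 \<and> proj_point w1 \<noteq> proj_point w2 \<longrightarrow>
        ((\<exists>M\<in>gen_ball_aut. boundary_action M (proj_point v1) (proj_point w1) \<and>
                            boundary_action M (proj_point v2) (proj_point w2)) \<longleftrightarrow>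
         (\<exists>\<alpha>. \<alpha> \<noteq> 0 \<and> hform v1 v2 = \<alpha> * hform w1 w2)))"
proof (rule conjI[OF _ conjI])
  show "\<forall>x\<in>(gen_ball :: ('p + 'q) projpt set). \<forall>y\<in>gen_ball. \<exists>M\<in>gen_ball_aut. M x = y"
    by (intro ballI) (rule gen_ball_transitive; assumption)
  show "\<forall>x\<in>(gen_ball_boundary :: ('p + 'q) projpt set). \<forall>y\<in>gen_ball_boundary.
      \<exists>M\<in>gen_ball_aut. boundary_action M x y"
    by (intro ballI) (rule gen_ball_boundary_transitive; assumption)
qed (intro allI impI, elim conjE, rule gen_ball_boundary_pairs; assumption)

end
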